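(* Let $G=(V,E)$ be a finite directed graph (loops and multiple edges allowed) with no sources, i.e. $\mathrm{indeg}(v)\ge 1$ for every $v\in V$. Then, as polynomials in the indeterminates $(x_e)_{e\in E}$, $$\kappa^{vertex}(\mathcal{L}G,\mathbf{x}) = \kappa^{edge}(G,\mathbf{x}) \prod_{v \in V} \Big( \sum_{e\in E:\ \mathtt{s}(e)=v} x_e \Big)^{\mathrm{indeg}(v)-1}.$$
   Context: A finite directed graph $G=(V,E)$ has finite vertex and edge sets and source and target maps $\mathtt{s},\mathtt{t}:E\to V$; each edge $e$ is directed from $\mathtt{s}(e)$ to $\mathtt{t}(e)$. Loops and multiple edges are allowed. $\mathrm{indeg}(v)=\#\{e\in E : \mathtt{t}(e)=v\}$; a vertex $v$ is a source if $\mathrm{indeg}(v)=0$. The directed line graph $\mathcal{L}G=(E,E_2)$ has vertex set $E$ and edge set $E_2=\{(e_1,e_2)\in E\times E : \mathtt{s}(e_2)=\mathtt{t}(e_1)\}$, where the edge $(e_1,e_2)$ is directed from $e_1$ to $e_2$. An oriented spanning tree of a directed graph is a subgraph containing all the vertices, having no directed cycles, in which one vertex (the root) has outdegree $0$ and every other vertex has outdegree $1$. Identify a tree $T$ with its set of edges. For a finite directed graph $H$, with an indeterminate $x_e$ for each edge and $x_v$ for each vertex, $$\kappa^{edge}(H,\mathbf{x})=\sum_T\prod_{e\in T}x_e,\qquad \kappa^{vertex}(H,\mathbf{x})=\sum_T\prod_{e\in T}x_{\mathtt{t}(e)},$$ where the sums are over all oriented spanning trees $T$ of $H$ (with any root).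 Since the vertex set of $\mathcal{L}G$ is $E$, $\kappa^{vertex}(\mathcal{L}G,\mathbf{x})$ is a polynomial in the variables $(x_e)_{e\in E}$, the same variables as in $\kappa^{edge}(G,\mathbf{x})$. Empty sums are $0$, empty products are $1$, and a zeroth power equals $1$. *)

theory Defs
  imports "Graph_Theory.Digraph_Component" "Graph_Theory.Arc_Walk" "HOL-Library.Poly_Mapping"
begin

text \<open>
  Integer polynomials in commuting indeterminates indexed by a type: finitely supported maps from
  monomials (finitely supported exponent vectors) to coefficients, multiplied by convolution.
\<close>
type_synonym 'i mpoly_int = "('i \<Rightarrow>\<^sub>0 nat) \<Rightarrow>\<^sub>0 int"

definition indet :: "'i \<Rightarrow> 'i mpoly_int" where
  "indet i = Poly_Mapping.single (Poly_Mapping.single i 1) 1"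

definition line_digraph :: "('v, 'e) pre_digraph \<Rightarrow> ('e, 'e \<times> 'e) pre_digraph" where
  "line_digraph G =
     \<lparr> verts = arcs G,
       arcs = {(e1, e2). e1 \<in> arcs G \<and> e2 \<in> arcs G \<and> tail G e2 = head G e1},
       tail = fst,
       head = snd \<rparr>"

text \<open>
  The edge direction is from \<open>tail\<close> to \<open>head\<close>, so that \<open>tail\<close> is the source map and \<open>head\<close> is the
  target map. \<open>pre_digraph.cycle\<close> counts loops as cycles, but not the empty walk.
\<close>
definition oriented_spanning_tree :: "('v, 'e) pre_digraph \<Rightarrow> ('v, 'e) pre_digraph \<Rightarrow> bool" where
  "oriented_spanning_tree T H \<longleftrightarrow>
     spanning T H \<and>
     (\<nexists>p. pre_digraph.cycle T p) \<and>
     (\<exists>r\<in>verts T. out_degree T r = 0 \<and> (\<forall>v\<in>verts T - {r}. out_degree T v = 1))"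

text \<open>A tree is identified with its set of edges.\<close>
definition oriented_spanning_trees :: "('v, 'e) pre_digraph \<Rightarrow> 'e set set" where
  "oriented_spanning_trees H = arcs ` {T. oriented_spanning_tree T H}"

definition kappa_edge :: "('v, 'e) pre_digraph \<Rightarrow> 'e mpoly_int" where
  "kappa_edge H = (\<Sum>T\<in>oriented_spanning_trees H. \<Prod>e\<in>T. indet e)"

definition kappa_vertex :: "('v, 'e) pre_digraph \<Rightarrow> 'v mpoly_int" where
  "kappa_vertex H = (\<Sum>T\<in>oriented_spanning_trees H. \<Prod>e\<in>T. indet (head H e))"

end

theory Submission
  imports Defs "HOL-Computational_Algebra.Polynomial"
begin

text \<open>
  The identity holds more generally for rooted spanning forests, where every node either is a root,
  with weight an extra indeterminate \<open>X\<close>, or picks one outgoing arc. In the line digraph the arcs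
  leaving a node \<open>e\<close> correspond to the arcs of \<open>G\<close> leaving the head of \<open>e\<close>, with the same weights. So
  all nodes \<open>e\<close> with the same head \<open>v\<close> have the same choices, and identifying all of them, for every
  \<open>v\<close>, turns the line digraph into \<open>G\<close> itself: if there are no sources, every vertex arises in this way.

  It remains to see how the forest sum changes when two nodes \<open>a\<close> and \<open>b\<close> with the same choices are
  identified (\<open>forest_sum_merge\<close>). Fix acyclic choices of the other nodes. Following them from a choice
  of \<open>a\<close> or \<open>b\<close>, one arrives at \<open>a\<close>, at \<open>b\<close>, or at a root; let \<open>A\<close>, \<open>B\<close> and \<open>S\<close> be the
  total weights of the choices of these three kinds. The choice \<open>c\<close> of \<open>a\<close> and the choice \<open>d\<close> of
  \<open>b\<close> create no cycle if \<open>c\<close> leads to a root and \<open>d\<close> does not lead to \<open>b\<close>, or if \<open>c\<close> leads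
  to \<open>b\<close> and \<open>d\<close> leads to a root. The total weight of these pairs is \<open>S * (S + A) + B * S\<close>,
  which is \<open>(A + B + S) * S\<close>. After the identification the total weight is \<open>S\<close>. Hence each
  identification divides out the total weight of all choices of the node, and a vertex of indegree
  \<open>k\<close> takes \<open>k - 1\<close> identifications (\<open>forest_sum_quotient\<close>).

  For \<open>G\<close> and its line digraph this gives an identity of polynomials in \<open>X\<close>, in which
  the total weight at \<open>v\<close> is \<open>X\<close> plus the sum of the indeterminates of the arcs leaving \<open>v\<close>. The coefficient of \<open>X\<close> in a
  forest sum collects the forests with exactly one root, which are the oriented spanning trees
  (\<open>sum_oriented_spanning_trees\<close>). As every forest on a nonempty vertex set has a root, comparing the
  coefficients of \<open>X\<close> sets \<open>X = 0\<close> in the remaining factors, and the theorem follows.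
\<close>

section \<open>Rooted forests as acyclic choice functions\<close>

text \<open>
  A forest is given by the choice that each node makes; a choice \<open>c\<close> is sent to the next node by
  \<open>nx\<close>, and \<open>nx c = None\<close> makes the node a root. Choices are kept apart from the nodes they lead to, so
  that an identification of nodes changes \<open>nx\<close> but leaves the choices and their weights alone.
\<close>

definition succ_rel :: "('c \<Rightarrow> 'n option) \<Rightarrow> 'n set \<Rightarrow> ('n \<Rightarrow> 'c) \<Rightarrow> ('n \<times> 'n) set" where
  "succ_rel nx N f = {(n, m). n \<in> N \<and> nx (f n) = Some m}"

definition rooted_forests :: "'n set \<Rightarrow> ('n \<Rightarrow> 'c set) \<Rightarrow> ('c \<Rightarrow> 'n option) \<Rightarrow> ('n \<Rightarrow> 'c) set" where
  "rooted_forests N C nx = {f \<in> Pi\<^sub>E N C. acyclic (succ_rel nx N f)}"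

definition forest_sum ::
  "('c \<Rightarrow> 'r::comm_semiring_1) \<Rightarrow> 'n set \<Rightarrow> ('n \<Rightarrow> 'c set) \<Rightarrow> ('c \<Rightarrow> 'n option) \<Rightarrow> 'r" where
  "forest_sum w N C nx = (\<Sum>f\<in>rooted_forests N C nx. \<Prod>n\<in>N. w (f n))"

lemma acyclic_hom:
  assumes "acyclic S" and hom: "\<And>x y. (x, y) \<in> R \<Longrightarrow> (h x, h y) \<in> S"
  shows "acyclic R"
proof (rule acyclicI, intro allI notI)
  have "(h x, h y) \<in> S\<^sup>+" if "(x, y) \<in> R\<^sup>+" for x y
    using that by (induction rule: trancl_induct) (auto intro: hom trancl_into_trancl)
  moreover fix x assume "(x, x) \<in> R\<^sup>+"
  ultimately show False
    using \<open>acyclic S\<close> unfolding acyclic_def by blast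
qed

text \<open>
  Nodes and choices can be relabelled independently of each other. Relabelling nodes settles the
  quotient by an injective map; relabelling choices is needed for the line digraph, whose arcs
  \<open>(e, e')\<close> leaving \<open>e\<close> stand for the arcs \<open>e'\<close> of the original digraph.
\<close>

lemma forest_sum_reindex:
  assumes inj: "inj_on q N" and M: "M = q ` N"
    and bij: "\<And>n. n \<in> N \<Longrightarrow> bij_betw (\<psi> n) (C n) (D (q n))"
    and closed: "\<And>n c. n \<in> N \<Longrightarrow> c \<in> C n \<Longrightarrow> set_option (nx c) \<subseteq> N"
    and nx: "\<And>n c. n \<in> N \<Longrightarrow> c \<in> C n \<Longrightarrow> nx' (\<psi> n c) = map_option q (nx c)"
    and w: "\<And>n c. n \<in> N \<Longrightarrow> c \<in> C n \<Longrightarrow> w' (\<psi> n c) = w c"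
  shows "forest_sum w N C nx = forest_sum w' M D nx'"
proof -
  define p where "p = inv_into N q"
  define fwd where "fwd f = (\<lambda>m\<in>M. \<psi> (p m) (f (p m)))" for f
  define bwd where "bwd g = (\<lambda>n\<in>N. inv_into (C n) (\<psi> n) (g (q n)))" for g
  have pq: "p (q n) = n" if "n \<in> N" for n
    using inj that by (simp add: p_def)
  have qp: "q (p m) = m" "p m \<in> N" if "m \<in> M" for m
    using that M by (auto simp: p_def f_inv_into_f inv_into_into)
  have fwd_mem: "fwd f \<in> Pi\<^sub>E M D" if "f \<in> Pi\<^sub>E N C" for f
  proof -
    have "\<psi> (p m) (f (p m)) \<in> D m" if "m \<in> M" for m
      using bij_betw_apply[OF bij[of "p m"], of "f (p m)"] qp[OF that] \<open>f \<in> Pi\<^sub>E N C\<close> by auto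
    then show ?thesis by (auto simp: fwd_def)
  qed
  have bwd_val: "inv_into (C n) (\<psi> n) (g (q n)) \<in> C n"
      "\<psi> n (inv_into (C n) (\<psi> n) (g (q n))) = g (q n)"
    if "g \<in> Pi\<^sub>E M D" "n \<in> N" for g n
  proof -
    have "g (q n) \<in> \<psi> n ` C n"
      using that M bij[of n] by (auto simp: bij_betw_def)
    then show "inv_into (C n) (\<psi> n) (g (q n)) \<in> C n"
      "\<psi> n (inv_into (C n) (\<psi> n) (g (q n))) = g (q n)"
      by (auto intro: inv_into_into f_inv_into_f)
  qed
  have bwd_mem: "bwd g \<in> Pi\<^sub>E N C" if "g \<in> Pi\<^sub>E M D" for g
    using bwd_val[OF that] by (auto simp: bwd_def)
  have bwd_fwd: "bwd (fwd f) = f" if f: "f \<in> Pi\<^sub>E N C" for f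
  proof (rule PiE_ext[OF bwd_mem[OF fwd_mem[OF f]] f])
    fix n assume n: "n \<in> N"
    then show "bwd (fwd f) n = f n"
      using bij[OF n] f M
      by (auto simp: bwd_def fwd_def pq bij_betw_def intro!: inv_into_f_f)
  qed
  have fwd_bwd: "fwd (bwd g) = g" if g: "g \<in> Pi\<^sub>E M D" for g
  proof (rule PiE_ext[OF fwd_mem[OF bwd_mem[OF g]] g])
    fix m assume m: "m \<in> M"
    then show "fwd (bwd g) m = g m"
      using bwd_val[OF g, of "p m"] qp[OF m] by (simp add: bwd_def fwd_def)
  qed
  have nx_fwd: "nx' (fwd f (q n)) = map_option q (nx (f n))" and w_fwd: "w' (fwd f (q n)) = w (f n)"
    if "f \<in> Pi\<^sub>E N C" "n \<in> N" for f n
    using that M nx[of n "f n"] w[of n "f n"] by (auto simp: fwd_def pq)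
  have acyc: "acyclic (succ_rel nx' M (fwd f)) \<longleftrightarrow> acyclic (succ_rel nx N f)"
    if f: "f \<in> Pi\<^sub>E N C" for f
  proof
    assume "acyclic (succ_rel nx' M (fwd f))"
    then show "acyclic (succ_rel nx N f)"
      by (rule acyclic_hom[where h = q]) (use M in \<open>auto simp: succ_rel_def nx_fwd[OF f]\<close>)
  next
    assume "acyclic (succ_rel nx N f)"
    then show "acyclic (succ_rel nx' M (fwd f))"
    proof (rule acyclic_hom[where h = p])
      fix x y assume "(x, y) \<in> succ_rel nx' M (fwd f)"
      then obtain n where n: "n \<in> N" "x = q n" "nx' (fwd f (q n)) = Some y"
        using M by (auto simp: succ_rel_def)
      then obtain m where m: "nx (f n) = Some m" "y = q m"
        by (auto simp: nx_fwd[OF f])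
      moreover have "m \<in> N"
        using closed[of n "f n"] n f m by auto
      ultimately show "(p x, p y) \<in> succ_rel nx N f"
        using n by (auto simp: succ_rel_def pq)
    qed
  qed
  show ?thesis
    unfolding forest_sum_def
  proof (rule sum.reindex_bij_witness[where i = bwd and j = fwd])
    fix f assume "f \<in> rooted_forests N C nx"
    then have f: "f \<in> Pi\<^sub>E N C" "acyclic (succ_rel nx N f)"
      by (auto simp: rooted_forests_def)
    show "bwd (fwd f) = f" "fwd f \<in> rooted_forests M D nx'"
      using f by (auto simp: bwd_fwd fwd_mem acyc rooted_forests_def)
    show "(\<Prod>m\<in>M. w' (fwd f m)) = (\<Prod>n\<in>N. w (f n))"
      by (simp add: M prod.reindex[OF inj] w_fwd[OF f(1)])
  next
    fix g assume "g \<in> rooted_forests M D nx'"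
    then have g: "g \<in> Pi\<^sub>E M D" "acyclic (succ_rel nx' M g)"
      by (auto simp: rooted_forests_def)
    show "fwd (bwd g) = g" "bwd g \<in> rooted_forests N C nx"
      using g acyc[OF bwd_mem[OF g(1)]]
      by (auto simp: fwd_bwd bwd_mem rooted_forests_def)
  qed
qed

section \<open>Identifying nodes that have the same choices\<close>

lemma sum_PiE_insert:
  assumes "x \<notin> S"
  shows "(\<Sum>f\<in>Pi\<^sub>E (insert x S) T. F f) = (\<Sum>g\<in>Pi\<^sub>E S T. \<Sum>y\<in>T x. F (g(x := y)))"
proof -
  have "(\<Sum>f\<in>Pi\<^sub>E (insert x S) T. F f) = (\<Sum>(y, g)\<in>T x \<times> Pi\<^sub>E S T. F (g(x := y)))"
    unfolding PiE_insert_eq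
    by (subst sum.reindex[OF inj_combinator[OF assms]]) (simp add: case_prod_unfold)
  also have "\<dots> = (\<Sum>g\<in>Pi\<^sub>E S T. \<Sum>y\<in>T x. F (g(x := y)))"
    by (simp add: sum.cartesian_product[symmetric] sum.swap[of _ "Pi\<^sub>E S T"])
  finally show ?thesis .
qed

lemma forest_sum_alt:
  assumes "finite N" "\<And>n. n \<in> N \<Longrightarrow> finite (C n)"
  shows "forest_sum w N C nx =
    (\<Sum>f\<in>Pi\<^sub>E N C. if acyclic (succ_rel nx N f) then \<Prod>n\<in>N. w (f n) else 0)"
  unfolding forest_sum_def rooted_forests_def
  by (rule sum.inter_filter) (intro finite_PiE assms)

definition leads_to :: "('c \<Rightarrow> 'n option) \<Rightarrow> ('n \<times> 'n) set \<Rightarrow> 'c \<Rightarrow> 'n \<Rightarrow> bool" where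
  "leads_to nx R c n \<longleftrightarrow> (\<exists>m. nx c = Some m \<and> (m, n) \<in> R\<^sup>*)"

lemma succ_rel_insert:
  assumes "x \<notin> S"
  shows "succ_rel nx (insert x S) (g(x := c)) =
    (case nx c of None \<Rightarrow> succ_rel nx S g | Some m \<Rightarrow> insert (x, m) (succ_rel nx S g))"
  using assms by (auto simp: succ_rel_def split: option.split if_splits)

lemma acyclic_succ_rel_insert:
  assumes "x \<notin> S"
  shows "acyclic (succ_rel nx (insert x S) (g(x := c))) \<longleftrightarrow>
    acyclic (succ_rel nx S g) \<and> \<not> leads_to nx (succ_rel nx S g) c x"
  using assms by (auto simp: succ_rel_insert leads_to_def split: option.split)

lemma leads_to_succ_rel_insert:
  assumes "x \<notin> S"
  shows "leads_to nx (succ_rel nx (insert x S) (g(x := d))) c n \<longleftrightarrow>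
    leads_to nx (succ_rel nx S g) c n \<or>
    leads_to nx (succ_rel nx S g) c x \<and> leads_to nx (succ_rel nx S g) d n"
  using assms by (auto simp: succ_rel_insert leads_to_def rtrancl_insert split: option.split)

text \<open>
  Every node of \<open>S\<close> has at most one successor, and nodes outside \<open>S\<close> have none, so the walk that
  starts with the choice \<open>c\<close> can stop at one node at most.
\<close>

lemma leads_to_terminal_unique:
  assumes "leads_to nx (succ_rel nx S g) c a" "leads_to nx (succ_rel nx S g) c b"
    "a \<notin> S" "b \<notin> S"
  shows "a = b"
proof -
  let ?R = "succ_rel nx S g"
  obtain m where m: "(m, a) \<in> ?R\<^sup>*" "(m, b) \<in> ?R\<^sup>*"
    using assms by (auto simp: leads_to_def)
  have "single_valued ?R"
    by (auto simp: single_valued_def succ_rel_def)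
  then have "(a, b) \<in> ?R\<^sup>* \<or> (b, a) \<in> ?R\<^sup>*"
    using m by (rule single_valued_confluent)
  moreover have "y = x" if "(x, y) \<in> ?R\<^sup>*" "x \<notin> S" for x y
    using that by (auto simp: succ_rel_def elim: converse_rtranclE)
  ultimately show ?thesis
    using assms by blast
qed

text \<open>
  A walk can reach \<open>a\<close> or \<open>b\<close> only at its end, because neither has a successor. Redirecting the arrows
  into \<open>b\<close> to \<open>a\<close> therefore splices no two walks together, and no new cycle can appear.
\<close>

lemma identify_terminals:
  fixes R :: "('n \<times> 'n) set" and a b :: 'n
  defines "h \<equiv> id(b := a)"
  assumes dom: "Domain R \<subseteq> M" and "a \<notin> M" "b \<notin> M"
  defines "R' \<equiv> {(x, h y) |x y. (x, y) \<in> R}"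
  shows "acyclic R' \<longleftrightarrow> acyclic R"
    and "(h x, a) \<in> R'\<^sup>* \<longleftrightarrow> (x, a) \<in> R\<^sup>* \<or> (x, b) \<in> R\<^sup>*"
proof -
  have h_M: "h x = x" if "x \<in> M" for x
    using that \<open>b \<notin> M\<close> by (auto simp: h_def)
  have h_preimage: "y = x" if "h y = x" "x \<in> M" for x y
    using that \<open>a \<notin> M\<close> \<open>b \<notin> M\<close> by (auto simp: h_def split: if_splits)
  have push: "(h x, h y) \<in> R'" if "(x, y) \<in> R" for x y
  proof -
    have "h x = x"
      using that dom by (auto intro: h_M)
    then show ?thesis
      using that unfolding R'_def by blast
  qed
  have push_rtrancl: "(h x, h y) \<in> R'\<^sup>*" if "(x, y) \<in> R\<^sup>*" for x y
    using that by (induction rule: rtrancl_induct) (auto intro: push rtrancl_into_rtrancl)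
  have lift: "\<exists>y. h y = v \<and> (x, y) \<in> R\<^sup>*" if "(h x, v) \<in> R'\<^sup>*" for x v
    using that
  proof (induction rule: rtrancl_induct)
    case base
    then show ?case by blast
  next
    case (step y z)
    then obtain y' z' where y': "h y' = y" "(x, y') \<in> R\<^sup>*" and z': "z = h z'" "(y, z') \<in> R"
      by (auto simp: R'_def)
    then have "y' = y"
      using dom by (auto intro: h_preimage)
    then show ?case
      using y' z' by (auto intro: rtrancl_into_rtrancl)
  qed
  show "acyclic R' \<longleftrightarrow> acyclic R"
  proof
    show "acyclic R" if "acyclic R'"
      using that push by (rule acyclic_hom)
    show "acyclic R'" if "acyclic R"
    proof (rule acyclicI, intro allI notI)
      fix u assume "(u, u) \<in> R'\<^sup>+"
      then obtain v where "(u, v) \<in> R'" "(v, u) \<in> R'\<^sup>*"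
        by (meson tranclD)
      then obtain v' where v': "(u, v') \<in> R" "v = h v'" "u \<in> M"
        using dom by (auto simp: R'_def)
      then obtain y where "h y = u" "(v', y) \<in> R\<^sup>*"
        using lift \<open>(v, u) \<in> R'\<^sup>*\<close> by blast
      then have "(u, u) \<in> R\<^sup>+"
        using v' h_preimage by (metis rtrancl_into_trancl2)
      then show False
        using that by (auto simp: acyclic_def)
    qed
  qed
  show "(h x, a) \<in> R'\<^sup>* \<longleftrightarrow> (x, a) \<in> R\<^sup>* \<or> (x, b) \<in> R\<^sup>*"
  proof
    assume "(h x, a) \<in> R'\<^sup>*"
    then obtain y where "h y = a" "(x, y) \<in> R\<^sup>*"
      using lift by blast
    then show "(x, a) \<in> R\<^sup>* \<or> (x, b) \<in> R\<^sup>*"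
      by (auto simp: h_def split: if_splits)
  next
    have "h a = a" "h b = a"
      by (auto simp: h_def)
    then show "(h x, a) \<in> R'\<^sup>*" if "(x, a) \<in> R\<^sup>* \<or> (x, b) \<in> R\<^sup>*"
      using that push_rtrancl by metis
  qed
qed

text \<open>
  The weight count for two nodes with the same set \<open>C\<close> of choices: \<open>A\<close> and \<open>B\<close> mark the
  choices that lead to the first and to the second node, \<open>c\<close> is the choice of the first node and
  \<open>d\<close> that of the second. The admissible pairs form the two rectangles
  ``\<open>d\<close> avoids \<open>B\<close>, \<open>c\<close> avoids both'' and ``\<open>d\<close> avoids both, \<open>c\<close> in \<open>B\<close>''.
\<close>

lemma sum_noncyclic_pairs:
  fixes w :: "'c \<Rightarrow> 'r::comm_semiring_1"
  assumes "finite C" and disj: "\<And>c. c \<in> C \<Longrightarrow> \<not> (A c \<and> B c)"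
  shows "(\<Sum>d\<in>C. \<Sum>c\<in>C. if \<not> B d \<and> \<not> (A c \<or> B c \<and> A d) then w c * w d else 0) =
    (\<Sum>c\<in>C. w c) * (\<Sum>c | c \<in> C \<and> \<not> (A c \<or> B c). w c)"
proof -
  let ?S = "{c \<in> C. \<not> (A c \<or> B c)}" and ?B = "{c \<in> C. B c}" and ?nB = "{c \<in> C. \<not> B c}"
  have rectangle: "(\<Sum>p\<in>X \<times> Y. w (snd p) * w (fst p)) = sum w X * sum w Y" for X Y
    by (simp only: sum_product sum.cartesian_product case_prod_unfold) (simp only: mult.commute)
  let ?ok = "\<lambda>p. \<not> B (fst p) \<and> \<not> (A (snd p) \<or> B (snd p) \<and> A (fst p))"
  have "(\<Sum>d\<in>C. \<Sum>c\<in>C. if \<not> B d \<and> \<not> (A c \<or> B c \<and> A d) then w c * w d else 0) =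
      (\<Sum>p\<in>C \<times> C. if ?ok p then w (snd p) * w (fst p) else 0)"
    by (simp only: sum.cartesian_product case_prod_unfold)
  also have "\<dots> = (\<Sum>p\<in>{p \<in> C \<times> C. ?ok p}. w (snd p) * w (fst p))"
    using \<open>finite C\<close> by (intro sum.inter_filter[symmetric] finite_cartesian_product)
  also have "{p \<in> C \<times> C. ?ok p} = ?nB \<times> ?S \<union> ?S \<times> ?B"
    using disj by auto
  also have "(\<Sum>p\<in>?nB \<times> ?S \<union> ?S \<times> ?B. w (snd p) * w (fst p)) =
      (\<Sum>p\<in>?nB \<times> ?S. w (snd p) * w (fst p)) + (\<Sum>p\<in>?S \<times> ?B. w (snd p) * w (fst p))"
    using \<open>finite C\<close> by (intro sum.union_disjoint) auto
  also have "\<dots> = sum w ?nB * sum w ?S + sum w ?S * sum w ?B"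
    by (simp only: rectangle)
  also have "\<dots> = (sum w ?nB + sum w ?B) * sum w ?S"
    by (simp add: algebra_simps)
  also have "sum w ?nB + sum w ?B = sum w (?nB \<union> ?B)"
    using \<open>finite C\<close> by (intro sum.union_disjoint[symmetric]) auto
  also have "?nB \<union> ?B = C"
    by auto
  finally show ?thesis .
qed

text \<open>
  The factor that splits off does not depend on the choices of the other nodes, which is why the
  count of \<open>sum_noncyclic_pairs\<close>, done separately for each way to fix those choices, can be summed.
\<close>

lemma forest_sum_merge:
  fixes w :: "'c \<Rightarrow> 'r::comm_semiring_1"
  assumes N: "finite N" "a \<in> N" "b \<in> N" "a \<noteq> b"
    and C: "\<And>n. n \<in> N \<Longrightarrow> finite (C n)" "C a = C b"
  shows "forest_sum w N C nx =
    (\<Sum>c\<in>C a. w c) * forest_sum w (N - {b}) C (map_option (id(b := a)) \<circ> nx)"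
proof -
  define M where "M = N - {a, b}"
  define h where "h = id(b := a)"
  have fin: "finite M" and ab: "a \<notin> M" "b \<notin> M" "a \<notin> insert b M"
    using N by (auto simp: M_def)
  have N_eq: "N = insert a (insert b M)" and N_b: "N - {b} = insert a M"
    using N by (auto simp: M_def)
  let ?nx = "map_option h \<circ> nx"
  \<comment> \<open>Here \<open>g\<close> holds the choices of the nodes other than \<open>a\<close> and \<open>b\<close>.\<close>
  have inner: "(\<Sum>d\<in>C b. \<Sum>c\<in>C a. if acyclic (succ_rel nx N (g(b := d, a := c)))
        then \<Prod>n\<in>N. w ((g(b := d, a := c)) n) else 0) =
      sum w (C a) * (\<Sum>c\<in>C a. if acyclic (succ_rel ?nx (insert a M) (g(a := c)))
        then \<Prod>n\<in>insert a M. w ((g(a := c)) n) else 0)" for g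
  proof -
    define R where "R = succ_rel nx M g"
    define P where "P = (\<Prod>n\<in>M. w (g n))"
    define A where "A c \<longleftrightarrow> leads_to nx R c a" for c
    define B where "B c \<longleftrightarrow> leads_to nx R c b" for c
    have R': "succ_rel ?nx M g = {(x, h y) |x y. (x, y) \<in> R}"
      by (auto simp: succ_rel_def R_def)
    have dom: "Domain R \<subseteq> M"
      by (auto simp: R_def succ_rel_def)
    have "(h x, a) \<in> (succ_rel ?nx M g)\<^sup>* \<longleftrightarrow> (x, a) \<in> R\<^sup>* \<or> (x, b) \<in> R\<^sup>*" for x
      unfolding R' unfolding h_def by (rule identify_terminals(2)[OF dom ab(1,2)])
    then have "leads_to ?nx (succ_rel ?nx M g) c a \<longleftrightarrow> A c \<or> B c" for c
      by (cases "nx c") (auto simp: leads_to_def A_def B_def)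
    moreover have "acyclic (succ_rel ?nx M g) \<longleftrightarrow> acyclic R"
      unfolding R' unfolding h_def by (rule identify_terminals(1)[OF dom ab(1,2)])
    ultimately have ac1: "acyclic (succ_rel ?nx (insert a M) (g(a := c))) \<longleftrightarrow>
        acyclic R \<and> \<not> (A c \<or> B c)" for c
      by (simp add: acyclic_succ_rel_insert[OF ab(1)])
    have ac2: "acyclic (succ_rel nx N (g(b := d, a := c))) \<longleftrightarrow>
        acyclic R \<and> \<not> B d \<and> \<not> (A c \<or> B c \<and> A d)" for c d
      unfolding N_eq acyclic_succ_rel_insert[OF ab(3)] acyclic_succ_rel_insert[OF ab(2)]
        leads_to_succ_rel_insert[OF ab(2)]
      by (auto simp: A_def B_def R_def)
    have pr1: "(\<Prod>n\<in>insert a M. w ((g(a := c)) n)) = w c * P" for c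
    proof -
      have "(\<Prod>n\<in>M. w ((g(a := c)) n)) = P"
        unfolding P_def using ab by (intro prod.cong) auto
      then show ?thesis
        using fin ab by simp
    qed
    have pr2: "(\<Prod>n\<in>N. w ((g(b := d, a := c)) n)) = w c * w d * P" for c d
    proof -
      have "(\<Prod>n\<in>M. w ((g(b := d, a := c)) n)) = P"
        unfolding P_def using ab by (intro prod.cong) auto
      then show ?thesis
        unfolding N_eq using fin ab N(4) by (simp add: mult.assoc)
    qed
    have disj: "\<not> (A c \<and> B c)" for c
      using leads_to_terminal_unique[of nx M g c a b] ab N(4) by (auto simp: A_def B_def R_def)
    have finC: "finite (C a)"
      using C N by auto
    show ?thesis
    proof (cases "acyclic R")
      case True
      have "(\<Sum>d\<in>C b. \<Sum>c\<in>C a. if acyclic (succ_rel nx N (g(b := d, a := c)))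
          then \<Prod>n\<in>N. w ((g(b := d, a := c)) n) else 0) =
        (\<Sum>d\<in>C a. \<Sum>c\<in>C a. if \<not> B d \<and> \<not> (A c \<or> B c \<and> A d) then w c * w d else 0) * P"
        unfolding ac2 pr2 sum_distrib_right
        using True C(2) by (intro sum.cong) auto
      also have "\<dots> = sum w (C a) * ((\<Sum>c | c \<in> C a \<and> \<not> (A c \<or> B c). w c) * P)"
        by (simp only: sum_noncyclic_pairs[OF finC disj] mult.assoc)
      also have "(\<Sum>c | c \<in> C a \<and> \<not> (A c \<or> B c). w c) * P =
        (\<Sum>c\<in>C a. if \<not> (A c \<or> B c) then w c * P else 0)"
        unfolding sum.inter_filter[OF finC] sum_distrib_right by (intro sum.cong) auto
      finally show ?thesis
        using True unfolding ac1 pr1 by (simp only: simp_thms)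
    qed (simp add: ac1 ac2)
  qed
  have "forest_sum w N C nx =
      (\<Sum>g\<in>Pi\<^sub>E M C. \<Sum>d\<in>C b. \<Sum>c\<in>C a. if acyclic (succ_rel nx N (g(b := d, a := c)))
        then \<Prod>n\<in>N. w ((g(b := d, a := c)) n) else 0)"
    by (subst forest_sum_alt[OF N(1) C(1)], assumption)
       (subst N_eq, simp only: sum_PiE_insert[OF ab(3)] sum_PiE_insert[OF ab(2)])
  also have "\<dots> = sum w (C a) * (\<Sum>g\<in>Pi\<^sub>E M C. \<Sum>c\<in>C a.
      if acyclic (succ_rel ?nx (insert a M) (g(a := c)))
        then \<Prod>n\<in>insert a M. w ((g(a := c)) n) else 0)"
    unfolding inner sum_distrib_left ..
  also have "\<dots> = sum w (C a) * forest_sum w (insert a M) C ?nx"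
  proof -
    have "finite (insert a M)" "\<And>n. n \<in> insert a M \<Longrightarrow> finite (C n)"
      using fin C(1) N_eq by auto
    then show ?thesis
      by (simp only: forest_sum_alt sum_PiE_insert[OF ab(1)])
  qed
  finally show ?thesis
    unfolding N_b h_def .
qed

text \<open>
  Merging two nodes of the same fibre of \<open>q\<close> removes one node and one factor, until \<open>q\<close> is injective.
  The map \<open>q\<close> must be onto \<open>M\<close>: over an empty fibre the exponent would have to be \<open>- 1\<close>.
\<close>

lemma forest_sum_quotient:
  fixes w :: "'c \<Rightarrow> 'r::comm_semiring_1"
  assumes "finite N" and "M = q ` N"
    and fin: "\<And>m. m \<in> M \<Longrightarrow> finite (C m)"
    and "\<And>m c. m \<in> M \<Longrightarrow> c \<in> C m \<Longrightarrow> set_option (nx c) \<subseteq> N"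
  shows "forest_sum w N (\<lambda>n. C (q n)) nx =
    forest_sum w M C (map_option q \<circ> nx) *
    (\<Prod>m\<in>M. (\<Sum>c\<in>C m. w c) ^ (card {n \<in> N. q n = m} - 1))"
  using assms(1,2,4)
proof (induction "card N" arbitrary: N nx rule: less_induct)
  case less
  show ?case
  proof (cases "inj_on q N")
    case True
    have "{n \<in> N. q n = q n'} = {n'}" if "n' \<in> N" for n'
      using True that by (auto simp: inj_on_def)
    then have "(\<Prod>m\<in>M. (\<Sum>c\<in>C m. w c) ^ (card {n \<in> N. q n = m} - 1)) = 1"
      using less.prems(2) by (intro prod.neutral) auto
    moreover have "forest_sum w N (\<lambda>n. C (q n)) nx = forest_sum w M C (map_option q \<circ> nx)"
      using True less.prems
      by (intro forest_sum_reindex[where \<psi> = "\<lambda>_ c. c"]) (auto simp: bij_betw_def)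
    ultimately show ?thesis
      by simp
  next
    case False
    then obtain a b where ab: "a \<in> N" "b \<in> N" "a \<noteq> b" "q a = q b"
      by (auto simp: inj_on_def)
    define h where "h = id(b := a)"
    let ?N = "N - {b}" and ?W = "\<lambda>m. \<Sum>c\<in>C m. w c"
    let ?k = "\<lambda>m. card {n \<in> N. q n = m} - 1" and ?k' = "\<lambda>m. card {n \<in> ?N. q n = m} - 1"
    have h_N: "h ` N \<subseteq> ?N" and qh: "q \<circ> h = q"
      using ab by (auto simp: h_def)
    have M: "M = q ` ?N"
    proof -
      have "q ` N = q ` h ` N"
        using qh by (metis image_comp)
      also have "\<dots> \<subseteq> q ` ?N"
        using h_N by (rule image_mono)
      finally show ?thesis
        using less.prems(2) by auto
    qed
    have qa: "q a \<in> M"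
      using ab less.prems(2) by auto
    have finM: "finite M"
      using less.prems by simp
    have "forest_sum w N (\<lambda>n. C (q n)) nx =
        ?W (q a) * forest_sum w ?N (\<lambda>n. C (q n)) (map_option h \<circ> nx)"
      unfolding h_def using less.prems ab fin by (intro forest_sum_merge) auto
    also have "forest_sum w ?N (\<lambda>n. C (q n)) (map_option h \<circ> nx) =
        forest_sum w M C (map_option q \<circ> (map_option h \<circ> nx)) * (\<Prod>m\<in>M. ?W m ^ ?k' m)"
    proof (rule less.hyps)
      show "card ?N < card N"
        using less.prems(1) ab(2) by (rule card_Diff1_less)
      show "set_option ((map_option h \<circ> nx) c) \<subseteq> ?N" if "m \<in> M" "c \<in> C m" for m c
        using less.prems(3)[OF that] h_N by (auto simp: option.set_map)
    qed (use less.prems M in auto)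
    also have "map_option q \<circ> (map_option h \<circ> nx) = map_option q \<circ> nx"
      by (simp add: fun_eq_iff option.map_comp qh)
    also have "?W (q a) * (forest_sum w M C (map_option q \<circ> nx) * (\<Prod>m\<in>M. ?W m ^ ?k' m)) =
        forest_sum w M C (map_option q \<circ> nx) * (?W (q a) * (\<Prod>m\<in>M. ?W m ^ ?k' m))"
      by (simp add: ac_simps)
    also have "?W (q a) * (\<Prod>m\<in>M. ?W m ^ ?k' m) = (\<Prod>m\<in>M. ?W m ^ ?k m)"
    proof -
      have "?k (q a) = Suc (?k' (q a))"
      proof -
        have "card {n \<in> ?N. q n = q a} > 0"
          using less.prems(1) ab by (auto simp: card_gt_0_iff)
        moreover have "{n \<in> N. q n = q a} = insert b {n \<in> ?N. q n = q a}"
          using ab by auto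
        then have "card {n \<in> N. q n = q a} = Suc (card {n \<in> ?N. q n = q a})"
          using less.prems(1) by simp
        ultimately show ?thesis
          by simp
      qed
      moreover have "?k m = ?k' m" if "m \<in> M - {q a}" for m
      proof -
        have "{n \<in> N. q n = m} = {n \<in> ?N. q n = m}"
          using ab that by auto
        then show ?thesis by simp
      qed
      ultimately show ?thesis
        unfolding prod.remove[OF finM qa] by (simp add: mult.assoc)
    qed
    finally show ?thesis .
  qed
qed

section \<open>Oriented spanning trees as forests with one root\<close>

lemma (in wf_digraph) no_cycle_iff_acyclic:
  "(\<nexists>p. cycle p) \<longleftrightarrow> acyclic (arcs_ends G)"
proof
  assume "\<nexists>p. cycle p"
  then have "\<not> closed_w p" for p
    using closed_w_imp_cycle by blast
  then show "acyclic (arcs_ends G)"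
    by (auto simp: acyclic_def reachable1_awalk closed_w_def)
next
  assume "acyclic (arcs_ends G)"
  then have "\<not> (awalk u p u \<and> p \<noteq> [])" for u p
    unfolding acyclic_def using reachable1_awalkI by blast
  then show "\<nexists>p. cycle p"
    by (auto simp: cycle_def)
qed

text \<open>
  The outdegree conditions in terms of the arc set alone: no two arcs of the tree share their tail, and
  exactly one vertex, the root, is not a tail.
\<close>

lemma oriented_spanning_trees_iff:
  assumes "fin_digraph H"
  shows "T \<in> oriented_spanning_trees H \<longleftrightarrow>
    T \<subseteq> arcs H \<and> inj_on (tail H) T \<and> acyclic ((\<lambda>e. (tail H e, head H e)) ` T) \<and>
    card (verts H - tail H ` T) = 1"
proof -
  interpret fin_digraph H by fact
  \<comment> \<open>A spanning subgraph is determined by its arcs, so \<open>K\<close> is the only candidate for the arc set \<open>T\<close>.\<close>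
  define K where "K = \<lparr>verts = verts H, arcs = T, tail = tail H, head = head H\<rparr>"
  have K_sel: "verts K = verts H" "arcs K = T" "tail K = tail H" "head K = head H"
    by (simp_all add: K_def)
  have spanning: "spanning X H \<and> arcs X = T \<longleftrightarrow> X = K \<and> T \<subseteq> arcs H" for X
  proof
    show "X = K \<and> T \<subseteq> arcs H" if "spanning X H \<and> arcs X = T"
      using that by (auto simp: spanning_def subgraph_def compatible_def K_def)
    show "spanning X H \<and> arcs X = T" if "X = K \<and> T \<subseteq> arcs H"
      using that wf_digraph
      by (auto simp: spanning_def subgraph_def compatible_def K_sel wf_digraph_def)
  qed
  have "T \<in> oriented_spanning_trees H \<longleftrightarrow> (\<exists>X. oriented_spanning_tree X H \<and> arcs X = T)"
    by (auto simp: oriented_spanning_trees_def)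
  also have "\<dots> \<longleftrightarrow> T \<subseteq> arcs H \<and> oriented_spanning_tree K H"
    unfolding oriented_spanning_tree_def using spanning by metis
  also have "\<dots> \<longleftrightarrow> T \<subseteq> arcs H \<and> acyclic ((\<lambda>e. (tail H e, head H e)) ` T) \<and>
      (\<exists>r\<in>verts H. out_degree K r = 0 \<and> (\<forall>v\<in>verts H - {r}. out_degree K v = 1))"
  proof (cases "T \<subseteq> arcs H")
    case True
    then have sp: "spanning K H"
      using spanning[of K] by simp
    then interpret K: wf_digraph K
      by (simp add: spanning_def subgraph_def)
    show ?thesis
      unfolding oriented_spanning_tree_def K.no_cycle_iff_acyclic arcs_ends_conv K_sel
      using sp True by simp
  qed simp
  also have "\<dots> \<longleftrightarrow> T \<subseteq> arcs H \<and> inj_on (tail H) T \<and>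
      acyclic ((\<lambda>e. (tail H e, head H e)) ` T) \<and> card (verts H - tail H ` T) = 1"
  proof -
    have "(\<exists>r\<in>verts H. out_degree K r = 0 \<and> (\<forall>v\<in>verts H - {r}. out_degree K v = 1)) \<longleftrightarrow>
        inj_on (tail H) T \<and> card (verts H - tail H ` T) = 1" (is "?L \<longleftrightarrow> ?R") if T: "T \<subseteq> arcs H"
    proof
      have fin_out: "finite (out_arcs K v)" for v
        using T finite_subset[OF _ finite_arcs, of "out_arcs K v"]
        by (auto simp: out_arcs_def K_sel)
      assume ?L
      then obtain r where r: "r \<in> verts H" "out_arcs K r = {}"
          and other: "\<And>v. v \<in> verts H \<Longrightarrow> v \<noteq> r \<Longrightarrow> card (out_arcs K v) = 1"
        using fin_out by (auto simp: out_degree_def)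
      have "inj_on (tail H) T"
      proof (rule inj_onI)
        fix e e' assume e: "e \<in> T" "e' \<in> T" "tail H e = tail H e'"
        then have "e \<in> out_arcs K (tail H e)" "e' \<in> out_arcs K (tail H e)"
          by (auto simp: out_arcs_def K_sel)
        moreover from this have "card (out_arcs K (tail H e)) = 1"
          using r e T by (intro other) auto
        ultimately show "e = e'"
          by (metis card_1_singletonE singletonD)
      qed
      moreover have "v \<in> tail H ` T" if v: "v \<in> verts H" "v \<noteq> r" for v
      proof -
        obtain e where "out_arcs K v = {e}"
          using other[OF v] by (rule card_1_singletonE)
        then have "e \<in> out_arcs K v"
          by simp
        then show ?thesis
          by (auto simp: out_arcs_def K_sel)
      qed
      moreover have "r \<notin> tail H ` T"
        using r by (auto simp: out_arcs_def K_sel)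
      ultimately have "inj_on (tail H) T" "verts H - tail H ` T = {r}"
        using r by auto
      then show ?R
        by simp
    next
      assume R: ?R
      then obtain r where r: "verts H - tail H ` T = {r}"
        using card_1_singletonE by blast
      have "out_degree K v = 1" if v: "v \<in> verts H" "v \<noteq> r" for v
      proof -
        obtain e where "e \<in> T" "v = tail H e"
          using r v by blast
        then have "out_arcs K v = {e}"
          using R by (auto simp: out_arcs_def K_sel inj_on_def)
        then show ?thesis
          by (simp add: out_degree_def)
      qed
      moreover have "out_arcs K r = {}"
        using r by (auto simp: out_arcs_def K_sel)
      ultimately show ?L
        using r by (intro bexI[of _ r]) (auto simp: out_degree_def)
    qed
    then show ?thesis by blast
  qed
  finally show ?thesis .
qed

definition arc_choices :: "('v, 'e) pre_digraph \<Rightarrow> 'v \<Rightarrow> 'e option set" where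
  "arc_choices H v = insert None (Some ` out_arcs H v)"

definition arc_weight :: "('e \<Rightarrow> 'r::comm_semiring_1) \<Rightarrow> 'e option \<Rightarrow> 'r poly" where
  "arc_weight y c = (case c of None \<Rightarrow> monom 1 1 | Some e \<Rightarrow> monom (y e) 0)"

text \<open>
  The coefficient of \<open>X ^ k\<close> in this polynomial sums the weights of the spanning forests of \<open>H\<close> with
  exactly \<open>k\<close> roots.
\<close>

abbreviation forest_poly :: "('e \<Rightarrow> 'r::comm_semiring_1) \<Rightarrow> ('v, 'e) pre_digraph \<Rightarrow> 'r poly" where
  "forest_poly y H \<equiv>
     forest_sum (arc_weight y) (verts H) (arc_choices H) (map_option (head H))"

lemma prod_arc_weight:
  assumes "finite V"
  shows "(\<Prod>v\<in>V. arc_weight y (f v)) =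
    monom (\<Prod>v | v \<in> V \<and> f v \<noteq> None. y (the (f v))) (card {v \<in> V. f v = None})"
  using assms
proof (induction V rule: finite_induct)
  case empty
  then show ?case by simp
next
  case (insert x V)
  have roots: "{v \<in> insert x V. f v = None} =
      (if f x = None then insert x {v \<in> V. f v = None} else {v \<in> V. f v = None})"
    by auto
  have nonroots: "{v \<in> insert x V. f v \<noteq> None} =
      (if f x = None then {v \<in> V. f v \<noteq> None} else insert x {v \<in> V. f v \<noteq> None})"
    by auto
  show ?case
    unfolding roots nonroots using insert
    by (cases "f x") (simp_all add: arc_weight_def mult_monom)
qed

text \<open>
  A tree corresponds to the choice function that assigns to each vertex other than the root the only
  arc of the tree leaving it, and the successor relation of this function is the arc relation of the
  tree.
\<close>

lemma sum_oriented_spanning_trees: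
  fixes y :: "'e \<Rightarrow> 'r::comm_semiring_1"
  assumes "fin_digraph H"
  shows "(\<Sum>T\<in>oriented_spanning_trees H. \<Prod>e\<in>T. y e) = coeff (forest_poly y H) 1"
proof -
  interpret fin_digraph H by fact
  let ?V = "verts H" and ?nx = "map_option (head H)"
  let ?F = "rooted_forests ?V (arc_choices H) ?nx"
  define arcs_of where "arcs_of f = {e. \<exists>v\<in>?V. f v = Some e}" for f :: "'a \<Rightarrow> 'e option"
  define choice_of where "choice_of T =
    (\<lambda>v\<in>?V. if v \<in> tail H ` T then Some (inv_into T (tail H) v) else None)" for T
  have finF: "finite ?F"
  proof (rule finite_subset)
    show "?F \<subseteq> Pi\<^sub>E ?V (arc_choices H)"
      by (auto simp: rooted_forests_def)
    show "finite (Pi\<^sub>E ?V (arc_choices H))"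
      by (intro finite_PiE) (auto simp: arc_choices_def)
  qed
  have choice: "e \<in> arcs H" "tail H e = v"
    if "f \<in> Pi\<^sub>E ?V (arc_choices H)" "v \<in> ?V" "f v = Some e" for f v e
    using PiE_mem[OF that(1,2)] that(3) by (auto simp: arc_choices_def out_arcs_def)
  have f_eq: "f v = Some e \<longleftrightarrow> e \<in> arcs_of f \<and> tail H e = v"
    if "f \<in> Pi\<^sub>E ?V (arc_choices H)" "v \<in> ?V" for f v e
    unfolding arcs_of_def using choice(2)[OF that(1)] that(2) by blast
  have arcs_of_sub: "arcs_of f \<subseteq> arcs H" and inj: "inj_on (tail H) (arcs_of f)"
    and nonroots: "{v \<in> ?V. f v \<noteq> None} = tail H ` arcs_of f"
    and roots: "{v \<in> ?V. f v = None} = ?V - tail H ` arcs_of f"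
    and rel: "succ_rel ?nx ?V f = (\<lambda>e. (tail H e, head H e)) ` arcs_of f"
    if f: "f \<in> Pi\<^sub>E ?V (arc_choices H)" for f
  proof -
    show sub: "arcs_of f \<subseteq> arcs H"
      unfolding arcs_of_def using choice(1)[OF f] by blast
    show "inj_on (tail H) (arcs_of f)"
    proof (rule inj_onI)
      fix e e' assume e: "e \<in> arcs_of f" "e' \<in> arcs_of f" "tail H e = tail H e'"
      then have "tail H e \<in> ?V"
        using sub by auto
      then have "f (tail H e) = Some e" "f (tail H e) = Some e'"
        using e f_eq[OF f] by simp_all
      then show "e = e'"
        by simp
    qed
    show tails: "{v \<in> ?V. f v \<noteq> None} = tail H ` arcs_of f"
    proof (intro set_eqI iffI)
      fix v assume "v \<in> {v \<in> ?V. f v \<noteq> None}"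
      then obtain e where "v \<in> ?V" "f v = Some e"
        by auto
      then show "v \<in> tail H ` arcs_of f"
        using f_eq[OF f] by auto
    next
      fix v assume "v \<in> tail H ` arcs_of f"
      then obtain e where e: "e \<in> arcs_of f" "v = tail H e"
        by auto
      then have "v \<in> ?V"
        using sub by auto
      then show "v \<in> {v \<in> ?V. f v \<noteq> None}"
        using f_eq[OF f, of v e] e by simp
    qed
    show "{v \<in> ?V. f v = None} = ?V - tail H ` arcs_of f"
      unfolding tails[symmetric] by auto
    show "succ_rel ?nx ?V f = (\<lambda>e. (tail H e, head H e)) ` arcs_of f"
    proof (intro set_eqI iffI; clarify)
      fix v u assume "(v, u) \<in> succ_rel ?nx ?V f"
      then obtain e where "v \<in> ?V" "f v = Some e" "u = head H e"
        by (auto simp: succ_rel_def)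
      then show "(v, u) \<in> (\<lambda>e. (tail H e, head H e)) ` arcs_of f"
        using f_eq[OF f] by auto
    next
      fix e assume e: "e \<in> arcs_of f"
      then have "tail H e \<in> ?V"
        using sub by auto
      then show "(tail H e, head H e) \<in> succ_rel ?nx ?V f"
        using f_eq[OF f, of "tail H e" e] e by (simp add: succ_rel_def)
    qed
  qed
  have choice_of_eq: "choice_of T v = Some e \<longleftrightarrow> e \<in> T \<and> tail H e = v"
    if T: "inj_on (tail H) T" and v: "v \<in> ?V" for T v e
  proof (cases "v \<in> tail H ` T")
    case True
    then obtain a where a: "a \<in> T" "v = tail H a"
      by blast
    then have "choice_of T v = Some a"
      using T v by (simp add: choice_of_def)
    moreover have "e \<in> T \<and> tail H e = v \<longleftrightarrow> e = a"
      using a inj_on_eq_iff[OF T, of e a] by blast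
    ultimately show ?thesis
      by auto
  next
    case False
    then show ?thesis
      using v by (auto simp: choice_of_def)
  qed
  have choice_of_mem: "choice_of T \<in> Pi\<^sub>E ?V (arc_choices H)"
    if T: "T \<subseteq> arcs H" "inj_on (tail H) T" for T
  proof
    fix v assume v: "v \<in> ?V"
    show "choice_of T v \<in> arc_choices H v"
    proof (cases "choice_of T v")
      case (Some e)
      then have "e \<in> T" "tail H e = v"
        using choice_of_eq[OF T(2) v, of e] by simp_all
      then show ?thesis
        using Some T(1) by (auto simp: arc_choices_def out_arcs_def)
    qed (simp add: arc_choices_def)
  qed (auto simp: choice_of_def)
  have arcs_of_choice_of: "arcs_of (choice_of T) = T" if "T \<subseteq> arcs H" "inj_on (tail H) T" for T
  proof -
    have "tail H e \<in> ?V" if "e \<in> T" for e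
      using that \<open>T \<subseteq> arcs H\<close> by auto
    then show ?thesis
      unfolding arcs_of_def using choice_of_eq[OF that(2)] by blast
  qed
  have "coeff (forest_poly y H) 1 =
      (\<Sum>f\<in>?F. if card {v \<in> ?V. f v = None} = 1
        then \<Prod>v | v \<in> ?V \<and> f v \<noteq> None. y (the (f v)) else 0)"
    unfolding forest_sum_def coeff_sum prod_arc_weight[OF finite_verts] coeff_monom ..
  also have "\<dots> = (\<Sum>f | f \<in> ?F \<and> card {v \<in> ?V. f v = None} = 1.
      \<Prod>v | v \<in> ?V \<and> f v \<noteq> None. y (the (f v)))"
    using finF by (rule sum.inter_filter[symmetric])
  also have "\<dots> = (\<Sum>T\<in>oriented_spanning_trees H. \<Prod>e\<in>T. y e)"
  proof (rule sum.reindex_bij_witness[where i = choice_of and j = arcs_of])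
    fix f assume "f \<in> {f \<in> ?F. card {v \<in> ?V. f v = None} = 1}"
    then have f: "f \<in> Pi\<^sub>E ?V (arc_choices H)" and ac: "acyclic (succ_rel ?nx ?V f)"
      and one: "card {v \<in> ?V. f v = None} = 1"
      by (simp_all add: rooted_forests_def)
    show "arcs_of f \<in> oriented_spanning_trees H"
      using ac one arcs_of_sub[OF f] inj[OF f]
      unfolding oriented_spanning_trees_iff[OF assms] rel[OF f] roots[OF f]
      by (intro conjI)
    show "choice_of (arcs_of f) = f"
    proof (rule PiE_ext[OF choice_of_mem[OF arcs_of_sub[OF f] inj[OF f]] f])
      fix v assume v: "v \<in> ?V"
      have "choice_of (arcs_of f) v = Some e \<longleftrightarrow> f v = Some e" for e
        unfolding choice_of_eq[OF inj[OF f] v] f_eq[OF f v] ..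
      then show "choice_of (arcs_of f) v = f v"
        by (cases "f v"; cases "choice_of (arcs_of f) v") auto
    qed
    have "(\<Prod>v | v \<in> ?V \<and> f v \<noteq> None. y (the (f v))) =
        (\<Prod>e\<in>arcs_of f. y (the (f (tail H e))))"
      unfolding nonroots[OF f] by (simp add: prod.reindex[OF inj[OF f]])
    also have "\<dots> = (\<Prod>e\<in>arcs_of f. y e)"
    proof (intro prod.cong refl)
      fix e assume e: "e \<in> arcs_of f"
      then have "f (tail H e) = Some e"
        using f_eq[OF f, of "tail H e" e] arcs_of_sub[OF f] by auto
      then show "y (the (f (tail H e))) = y e"
        by simp
    qed
    finally show "(\<Prod>e\<in>arcs_of f. y e) = (\<Prod>v | v \<in> ?V \<and> f v \<noteq> None. y (the (f v)))" ..
  next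
    fix T assume "T \<in> oriented_spanning_trees H"
    then have T: "T \<subseteq> arcs H" "inj_on (tail H) T" "acyclic ((\<lambda>e. (tail H e, head H e)) ` T)"
        "card (?V - tail H ` T) = 1"
      by (simp_all add: oriented_spanning_trees_iff[OF assms])
    have c: "choice_of T \<in> Pi\<^sub>E ?V (arc_choices H)" and a: "arcs_of (choice_of T) = T"
      using T by (auto simp: choice_of_mem arcs_of_choice_of)
    show "arcs_of (choice_of T) = T"
      by fact
    have "card {v \<in> ?V. choice_of T v = None} = 1" "acyclic (succ_rel ?nx ?V (choice_of T))"
      using T unfolding rel[OF c] roots[OF c] a by auto
    then show "choice_of T \<in> {f \<in> ?F. card {v \<in> ?V. f v = None} = 1}"
      using c by (simp add: rooted_forests_def)
  qed
  finally show ?thesis ..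
qed

text \<open>
  Otherwise the successors of a node could be followed forever inside the finite set \<open>N\<close>, which
  produces a cycle.
\<close>

lemma rooted_forest_has_root:
  assumes "finite N" "N \<noteq> {}" and f: "f \<in> rooted_forests N C nx"
    and closed: "\<And>n c. n \<in> N \<Longrightarrow> c \<in> C n \<Longrightarrow> set_option (nx c) \<subseteq> N"
  shows "\<exists>n\<in>N. nx (f n) = None"
proof -
  let ?R = "succ_rel nx N f"
  have next_in: "m \<in> N" if "n \<in> N" "nx (f n) = Some m" for n m
    using closed[of n "f n"] that f by (auto simp: rooted_forests_def)
  have "?R \<subseteq> N \<times> N"
    using next_in by (auto simp: succ_rel_def)
  then have "finite ?R"
    using \<open>finite N\<close> finite_subset by blast
  then have "wf (?R\<inverse>)"
    using f by (intro finite_acyclic_wf_converse) (auto simp: rooted_forests_def)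
  then obtain z where z: "z \<in> N" "\<And>m. (m, z) \<in> ?R\<inverse> \<Longrightarrow> m \<notin> N"
    using \<open>N \<noteq> {}\<close> by (meson wfE_min ex_in_conv)
  have "nx (f z) \<noteq> Some m" for m
    using z(2)[of m] next_in[OF z(1), of m] z(1) by (auto simp: succ_rel_def)
  then show ?thesis
    using z(1) by blast
qed

lemma coeff_0_forest_poly:
  assumes "fin_digraph H" "verts H \<noteq> {}"
  shows "coeff (forest_poly y H) 0 = 0"
proof -
  interpret fin_digraph H by fact
  have "card {v \<in> verts H. f v = None} \<noteq> 0"
    if "f \<in> rooted_forests (verts H) (arc_choices H) (map_option (head H))" for f
  proof -
    have "\<exists>v\<in>verts H. map_option (head H) (f v) = None"
      using that assms(2)
      by (intro rooted_forest_has_root[where C = "arc_choices H"])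
         (auto simp: arc_choices_def out_arcs_def)
    then show ?thesis
      by auto
  qed
  then show ?thesis
    unfolding forest_sum_def coeff_sum prod_arc_weight[OF finite_verts] coeff_monom
    by (intro sum.neutral ballI if_not_P)
qed

section \<open>The line digraph\<close>

lemma fin_digraph_line_digraph:
  assumes "fin_digraph G"
  shows "fin_digraph (line_digraph G)"
proof -
  interpret fin_digraph G by fact
  have "arcs (line_digraph G) \<subseteq> arcs G \<times> arcs G"
    by (auto simp: line_digraph_def)
  then have "finite (arcs (line_digraph G))"
    by (rule finite_subset) simp
  moreover have "finite (verts (line_digraph G))"
    by (simp add: line_digraph_def)
  moreover have "wf_digraph (line_digraph G)"
    by (auto simp: wf_digraph_def line_digraph_def)
  ultimately show ?thesis
    by (simp add: fin_digraph_def fin_digraph_axioms_def)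
qed

text \<open>
  The quotient map is \<open>head G\<close>, from the nodes of the line digraph, the arcs of \<open>G\<close>, to the vertices of
  \<open>G\<close>. It is onto because there are no sources, and its fibre over \<open>v\<close> has \<open>in_degree G v\<close> elements.
\<close>

lemma forest_poly_line_digraph:
  fixes y :: "'e \<Rightarrow> 'r::comm_semiring_1" and G :: "('v, 'e) pre_digraph"
  assumes "fin_digraph G" and no_sources: "\<And>v. v \<in> verts G \<Longrightarrow> in_degree G v \<ge> 1"
  shows "forest_poly (\<lambda>a. y (snd a)) (line_digraph G) =
    forest_poly y G *
    (\<Prod>v\<in>verts G. (monom 1 1 + (\<Sum>e\<in>out_arcs G v. monom (y e) 0)) ^ (in_degree G v - 1))"
proof -
  interpret fin_digraph G by fact
  let ?L = "line_digraph G"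
  have sum_choices: "(\<Sum>c\<in>arc_choices G v. arc_weight y c) =
      monom 1 1 + (\<Sum>e\<in>out_arcs G v. monom (y e) 0)" for v
    by (simp add: arc_choices_def arc_weight_def sum.reindex image_iff finite_out_arcs)
  have out_L: "out_arcs ?L e = Pair e ` out_arcs G (head G e)" if "e \<in> arcs G" for e
    using that by (auto simp: line_digraph_def out_arcs_def)
  have "forest_poly (\<lambda>a. y (snd a)) ?L =
      forest_sum (arc_weight y) (arcs G) (\<lambda>e. arc_choices G (head G e)) id"
  proof (rule forest_sum_reindex[where q = id and \<psi> = "\<lambda>_. map_option snd"])
    fix e assume "e \<in> verts ?L"
    then have e: "e \<in> arcs G"
      by (simp add: line_digraph_def)
    show "bij_betw (map_option snd) (arc_choices ?L e) (arc_choices G (head G (id e)))"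
      unfolding arc_choices_def out_L[OF e]
      by (auto simp: bij_betw_def inj_on_def image_image)
    fix c assume c: "c \<in> arc_choices ?L e"
    show "set_option (map_option (head ?L) c) \<subseteq> verts ?L"
      using c by (auto simp: arc_choices_def out_arcs_def line_digraph_def)
    show "id (map_option snd c) = map_option id (map_option (head ?L) c)"
      by (simp add: line_digraph_def option.map_id)
    show "arc_weight y (map_option snd c) = arc_weight (\<lambda>a. y (snd a)) c"
      by (cases c) (auto simp: arc_weight_def)
  qed (auto simp: line_digraph_def)
  also have "\<dots> = forest_sum (arc_weight y) (verts G) (arc_choices G) (map_option (head G) \<circ> id) *
      (\<Prod>v\<in>verts G. (\<Sum>c\<in>arc_choices G v. arc_weight y c) ^
        (card {e \<in> arcs G. head G e = v} - 1))"
  proof (rule forest_sum_quotient)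
    have "v \<in> head G ` arcs G" if "v \<in> verts G" for v
    proof -
      have "in_arcs G v \<noteq> {}"
        using no_sources[OF that] by (auto simp: in_degree_def)
      then show ?thesis
        by (auto simp: in_arcs_def)
    qed
    then show "verts G = head G ` arcs G"
      by auto
  qed (auto simp: arc_choices_def out_arcs_def)
  finally show ?thesis
    by (simp add: in_degree_def in_arcs_def sum_choices)
qed

theorem theorem1p1:
  fixes G :: "('v, 'e) pre_digraph"
  assumes "fin_digraph G"
    and "\<And>v. v \<in> verts G \<Longrightarrow> in_degree G v \<ge> 1"
  shows "kappa_vertex (line_digraph G) =
    kappa_edge G * (\<Prod>v\<in>verts G. (\<Sum>e\<in>out_arcs G v. indet e) ^ (in_degree G v - 1))"
proof -
  interpret fin_digraph G by fact
  define P where "P = forest_poly (indet :: 'e \<Rightarrow> 'e mpoly_int) G"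
  define Q where "Q = (\<Prod>v\<in>verts G.
    (monom 1 1 + (\<Sum>e\<in>out_arcs G v. monom (indet e :: 'e mpoly_int) 0)) ^ (in_degree G v - 1))"
  have "kappa_vertex (line_digraph G) = coeff (forest_poly (\<lambda>a. indet (snd a)) (line_digraph G)) 1"
    unfolding kappa_vertex_def
    using sum_oriented_spanning_trees[OF fin_digraph_line_digraph[OF assms(1)],
      where y = "\<lambda>a. indet (snd a)"]
    by (simp add: line_digraph_def)
  also have "\<dots> = coeff (P * Q) 1"
    unfolding P_def Q_def by (simp only: forest_poly_line_digraph[OF assms])
  also have "\<dots> = coeff P 1 * coeff Q 0"
    \<comment> \<open>The empty forest on an empty vertex set has no root, so \<open>coeff P 0\<close> is \<open>1\<close> there; but then \<open>Q = 1\<close>.\<close>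
  proof (cases "verts G = {}")
    case True
    then show ?thesis by (simp add: Q_def)
  next
    case False
    then have "coeff P 0 = 0"
      unfolding P_def by (rule coeff_0_forest_poly[OF assms(1)])
    then show ?thesis
      by (simp add: coeff_mult)
  qed
  also have "coeff P 1 = kappa_edge G"
    unfolding P_def kappa_edge_def sum_oriented_spanning_trees[OF assms(1)] ..
  also have "coeff Q 0 = (\<Prod>v\<in>verts G. (\<Sum>e\<in>out_arcs G v. indet e) ^ (in_degree G v - 1))"
    unfolding poly_0_coeff_0[symmetric] Q_def
    by (simp add: poly_prod poly_power poly_sum poly_monom)
  finally show ?thesis .
qed

end
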